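(* Let $n\ge3$. For any non-dihedral Hurwitz map $\phi$ and any $K\ge 2$, the subset $\mathcal{A}_\phi(K)=\{\gamma\in\mathcal{A}:|\phi(\gamma)|\le K\}$ of $\mathcal{A}$ is edge-connected.
   Context: Let $[n]=\{1,\dots,n\}$ and let $\Delta$ be the $n$-regular tree with a distinguished root vertex $v_0$ whose edges are labeled by elements of $[n]$ so that the $n$ edges at each vertex carry distinct labels. For a vertex $v$ and $I\subset[n]$, $[v;I]$ is the connected component containing $v$ of the forest obtained from $\Delta$ by deleting all (open) edges whose label is not in $I$. Write $\hat{i}=[n]\setminus\{i\}$. Let $\mathcal{X}$ be the set of all subtrees $[v;\hat{i}]$ and let $\mathcal{A}$ be the set of all $[v;\{i,j\}]$, $i\ne j$ (alternating geodesics). A Hurwitz map is a function $\phi:\mathcal{X}\to\mathbb{C}$ such that for every edge labeled $i$ with end vertices $v,v'$, $\phi([v;\hat{i}])+\phi([v';\hat{i}])=\prod_{j\ne i}\phi([v;\hat{j}])$. It is extended to $\mathcal{A}$ by $\phi([v;\{i,j\}])=\prod_{k\ne i,j}\phi([v;\hat{k}])$. $\phi$ is dihedral if at some (equivalently, every) vertex $v$ there are distinct $i,j$ with $\phi([v;\hat{i}])=\phi([v;\hat{j}])=0$. A subset $\mathcal{P}\subset\mathcal{A}$ is edge-connected if for every $\alpha,\beta\in\mathcal{P}$ there is a sequence $\gamma_1,\dots,\gamma_m\in\mathcal{P}$ with $\gamma_1=\alpha$, $\gamma_m=\beta$ and such that each adjacent pair $\gamma_i,\gamma_{i+1}$ shares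 a common edge. *)

theory Defs
  imports Complex_Main
begin

text \<open>An undirected simple graph is a pair (vertices, edges), an edge being the two-element set
  of its end vertices. Subtrees are kept as graphs, so that sharing an edge can be said directly.\<close>

type_synonym 'v ugraph = "'v set \<times> 'v set set"

abbreviation vertices :: "'v ugraph \<Rightarrow> 'v set" where "vertices \<equiv> fst"
abbreviation edges :: "'v ugraph \<Rightarrow> 'v set set" where "edges \<equiv> snd"

definition simple_graph :: "'v ugraph \<Rightarrow> bool" where
  "simple_graph G \<longleftrightarrow> (\<forall>e\<in>edges G. e \<subseteq> vertices G \<and> card e = 2)"

definition adjacency :: "'v ugraph \<Rightarrow> ('v \<times> 'v) set" where
  "adjacency G = {(u, v). {u, v} \<in> edges G}"

definition connected_graph :: "'v ugraph \<Rightarrow> bool" where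
  "connected_graph G \<longleftrightarrow>
     vertices G \<noteq> {} \<and> (\<forall>u\<in>vertices G. \<forall>v\<in>vertices G. (u, v) \<in> (adjacency G)\<^sup>*)"

definition is_cycle :: "'v ugraph \<Rightarrow> 'v list \<Rightarrow> bool" where
  "is_cycle G p \<longleftrightarrow> 3 \<le> length p \<and> distinct p \<and>
     (\<forall>k. Suc k < length p \<longrightarrow> {p ! k, p ! Suc k} \<in> edges G) \<and> {last p, hd p} \<in> edges G"

definition is_tree :: "'v ugraph \<Rightarrow> bool" where
  "is_tree G \<longleftrightarrow> simple_graph G \<and> connected_graph G \<and> (\<nexists>p. is_cycle G p)"

definition component :: "'v ugraph \<Rightarrow> 'v \<Rightarrow> 'v ugraph" where
  "component G v =
     (let C = {w\<in>vertices G. (v, w) \<in> (adjacency G)\<^sup>*} in (C, {e\<in>edges G. e \<subseteq> C}))"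

locale labelled_regular_tree =
  fixes n :: nat and \<Delta> :: "'v ugraph" and lab :: "'v set \<Rightarrow> nat" and v0 :: 'v
  assumes tree: "is_tree \<Delta>"
    and root: "v0 \<in> vertices \<Delta>"
    and regular: "\<And>v. v \<in> vertices \<Delta> \<Longrightarrow> card {e\<in>edges \<Delta>. v \<in> e} = n"
    and labels: "\<And>e. e \<in> edges \<Delta> \<Longrightarrow> lab e \<in> {1..n}"
    and distinct_labels: "\<And>v. v \<in> vertices \<Delta> \<Longrightarrow> inj_on lab {e\<in>edges \<Delta>. v \<in> e}"

text \<open>The subtree \<open>[v; I]\<close>. Deleting an open edge keeps its end vertices.\<close>

definition subtree :: "'v ugraph \<Rightarrow> ('v set \<Rightarrow> nat) \<Rightarrow> 'v \<Rightarrow> nat set \<Rightarrow> 'v ugraph" where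
  "subtree \<Delta> lab v I = component (vertices \<Delta>, {e\<in>edges \<Delta>. lab e \<in> I}) v"

definition alternating_geodesics ::
    "nat \<Rightarrow> 'v ugraph \<Rightarrow> ('v set \<Rightarrow> nat) \<Rightarrow> 'v ugraph set" where
  "alternating_geodesics n \<Delta> lab =
     {subtree \<Delta> lab v {i, j} | v i j. v \<in> vertices \<Delta> \<and> i \<in> {1..n} \<and> j \<in> {1..n} \<and> i \<noteq> j}"

text \<open>A map on the set of all \<open>[v; {1..n} - {i}]\<close> is represented by a function on all graphs;
  only its values on these subtrees are ever used.\<close>

definition hurwitz_map ::
    "nat \<Rightarrow> 'v ugraph \<Rightarrow> ('v set \<Rightarrow> nat) \<Rightarrow> ('v ugraph \<Rightarrow> complex) \<Rightarrow> bool" where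
  "hurwitz_map n \<Delta> lab \<phi> \<longleftrightarrow>
     (\<forall>v v' i. {v, v'} \<in> edges \<Delta> \<and> lab {v, v'} = i \<longrightarrow>
        \<phi> (subtree \<Delta> lab v ({1..n} - {i})) + \<phi> (subtree \<Delta> lab v' ({1..n} - {i})) =
        (\<Prod>j\<in>{1..n} - {i}. \<phi> (subtree \<Delta> lab v ({1..n} - {j}))))"

definition dihedral ::
    "nat \<Rightarrow> 'v ugraph \<Rightarrow> ('v set \<Rightarrow> nat) \<Rightarrow> ('v ugraph \<Rightarrow> complex) \<Rightarrow> bool" where
  "dihedral n \<Delta> lab \<phi> \<longleftrightarrow>
     (\<exists>v\<in>vertices \<Delta>. \<exists>i\<in>{1..n}. \<exists>j\<in>{1..n}. i \<noteq> j \<and>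
        \<phi> (subtree \<Delta> lab v ({1..n} - {i})) = 0 \<and> \<phi> (subtree \<Delta> lab v ({1..n} - {j})) = 0)"

text \<open>The extension of \<open>\<phi>\<close> to alternating geodesics; the product does not depend on the choice
  of \<open>v\<close>, \<open>i\<close>, \<open>j\<close>, as proved in \<open>geodesic_value_eq\<close> below.\<close>

definition geodesic_value ::
    "nat \<Rightarrow> 'v ugraph \<Rightarrow> ('v set \<Rightarrow> nat) \<Rightarrow> ('v ugraph \<Rightarrow> complex) \<Rightarrow> 'v ugraph \<Rightarrow> complex" where
  "geodesic_value n \<Delta> lab \<phi> \<gamma> =
     (THE c. \<exists>v\<in>vertices \<Delta>. \<exists>i\<in>{1..n}. \<exists>j\<in>{1..n}. i \<noteq> j \<and> \<gamma> = subtree \<Delta> lab v {i, j} \<and>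
        c = (\<Prod>k\<in>{1..n} - {i, j}. \<phi> (subtree \<Delta> lab v ({1..n} - {k}))))"

definition bounded_geodesics ::
    "nat \<Rightarrow> 'v ugraph \<Rightarrow> ('v set \<Rightarrow> nat) \<Rightarrow> ('v ugraph \<Rightarrow> complex) \<Rightarrow> real \<Rightarrow> 'v ugraph set" where
  "bounded_geodesics n \<Delta> lab \<phi> K =
     {\<gamma>\<in>alternating_geodesics n \<Delta> lab. norm (geodesic_value n \<Delta> lab \<phi> \<gamma>) \<le> K}"

definition edge_connected :: "'v ugraph set \<Rightarrow> bool" where
  "edge_connected P \<longleftrightarrow>
     (\<forall>\<alpha>\<in>P. \<forall>\<beta>\<in>P. \<exists>\<gamma>s. \<gamma>s \<noteq> [] \<and> set \<gamma>s \<subseteq> P \<and> hd \<gamma>s = \<alpha> \<and> last \<gamma>s = \<beta> \<and>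
        (\<forall>k. Suc k < length \<gamma>s \<longrightarrow> edges (\<gamma>s ! k) \<inter> edges (\<gamma>s ! Suc k) \<noteq> {}))"

context labelled_regular_tree
begin

lemma ex_edge:
  assumes v: "v \<in> vertices \<Delta>" and i: "i \<in> {1..n}"
  obtains e where "e \<in> edges \<Delta>" "v \<in> e" "lab e = i"
proof -
  let ?S = "{e\<in>edges \<Delta>. v \<in> e}"
  have sub: "lab ` ?S \<subseteq> {1..n}" using labels by blast
  have "card (lab ` ?S) = n"
    using card_image[OF distinct_labels[OF v]] regular[OF v] by simp
  then have "lab ` ?S = {1..n}" using sub by (simp add: card_subset_eq)
  with i have "i \<in> lab ` ?S" by simp
  then show ?thesis using that by blast
qed

lemma sym_adjacency: "sym (adjacency G)"
  by (auto simp: adjacency_def sym_def insert_commute)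

lemma component_eq:
  assumes "w \<in> vertices (component G v)"
  shows "component G w = component G v"
proof -
  have vw: "(v, w) \<in> (adjacency G)\<^sup>*" using assms by (simp add: component_def Let_def)
  then have "(w, v) \<in> (adjacency G)\<^sup>*" using sym_rtrancl[OF sym_adjacency] by (meson symD)
  with vw have "(w, u) \<in> (adjacency G)\<^sup>* \<longleftrightarrow> (v, u) \<in> (adjacency G)\<^sup>*" for u
    by (meson rtrancl_trans)
  then show ?thesis by (simp add: component_def)
qed

lemma labels_subtree:
  assumes v: "v \<in> vertices \<Delta>" and I: "I \<subseteq> {1..n}"
  shows "lab ` edges (subtree \<Delta> lab v I) = I"
proof
  show "lab ` edges (subtree \<Delta> lab v I) \<subseteq> I"
    by (auto simp: subtree_def component_def Let_def)
  show "I \<subseteq> lab ` edges (subtree \<Delta> lab v I)"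
  proof
    fix i assume i: "i \<in> I"
    then obtain e where e: "e \<in> edges \<Delta>" "v \<in> e" "lab e = i" using ex_edge[OF v] I by blast
    from tree e(1) have "e \<subseteq> vertices \<Delta>" "card e = 2"
      by (auto simp: is_tree_def simple_graph_def)
    then obtain w where w: "e = {v, w}" "w \<in> vertices \<Delta>"
      using e(2) by (auto simp: card_2_iff)
    let ?G = "(vertices \<Delta>, {e\<in>edges \<Delta>. lab e \<in> I})"
    have "(v, w) \<in> adjacency ?G" using e w i by (simp add: adjacency_def)
    then have "e \<in> edges (subtree \<Delta> lab v I)"
      using e w i v by (auto simp: subtree_def component_def Let_def)
    then show "i \<in> lab ` edges (subtree \<Delta> lab v I)" using e(3) by blast
  qed
qed

lemma vertex_in_subtree: "v \<in> vertices \<Delta> \<Longrightarrow> v \<in> vertices (subtree \<Delta> lab v I)"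
  by (simp add: subtree_def component_def Let_def)

lemma subtree_eq:
  assumes "w \<in> vertices (subtree \<Delta> lab v I)" "I \<subseteq> J"
  shows "subtree \<Delta> lab w J = subtree \<Delta> lab v J"
proof -
  have "adjacency (vertices \<Delta>, {e\<in>edges \<Delta>. lab e \<in> I})
      \<subseteq> adjacency (vertices \<Delta>, {e\<in>edges \<Delta>. lab e \<in> J})"
    using assms(2) by (auto simp: adjacency_def)
  from rtrancl_mono[OF this] assms(1) have "w \<in> vertices (subtree \<Delta> lab v J)"
    by (auto simp: subtree_def component_def Let_def)
  then show ?thesis unfolding subtree_def by (rule component_eq)
qed

lemma geodesic_value_eq:
  assumes v: "v \<in> vertices \<Delta>" and i: "i \<in> {1..n}" and j: "j \<in> {1..n}" and ij: "i \<noteq> j"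
  shows "geodesic_value n \<Delta> lab \<phi> (subtree \<Delta> lab v {i, j}) =
    (\<Prod>k\<in>{1..n} - {i, j}. \<phi> (subtree \<Delta> lab v ({1..n} - {k})))"
  unfolding geodesic_value_def
proof (rule the_equality)
  show "\<exists>v'\<in>vertices \<Delta>. \<exists>i'\<in>{1..n}. \<exists>j'\<in>{1..n}. i' \<noteq> j' \<and>
      subtree \<Delta> lab v {i, j} = subtree \<Delta> lab v' {i', j'} \<and>
      (\<Prod>k\<in>{1..n} - {i, j}. \<phi> (subtree \<Delta> lab v ({1..n} - {k}))) =
      (\<Prod>k\<in>{1..n} - {i', j'}. \<phi> (subtree \<Delta> lab v' ({1..n} - {k})))"
    using assms by blast
next
  fix c
  assume "\<exists>v'\<in>vertices \<Delta>. \<exists>i'\<in>{1..n}. \<exists>j'\<in>{1..n}. i' \<noteq> j' \<and>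
      subtree \<Delta> lab v {i, j} = subtree \<Delta> lab v' {i', j'} \<and>
      c = (\<Prod>k\<in>{1..n} - {i', j'}. \<phi> (subtree \<Delta> lab v' ({1..n} - {k})))"
  then obtain w i' j' where w: "w \<in> vertices \<Delta>" "i' \<in> {1..n}" "j' \<in> {1..n}"
    and eq: "subtree \<Delta> lab v {i, j} = subtree \<Delta> lab w {i', j'}"
    and c: "c = (\<Prod>k\<in>{1..n} - {i', j'}. \<phi> (subtree \<Delta> lab w ({1..n} - {k})))"
    by blast
  have I: "{i, j} = {i', j'}"
    using labels_subtree[OF v, of "{i, j}"] labels_subtree[OF w(1), of "{i', j'}"] eq i j w
    by simp
  have "w \<in> vertices (subtree \<Delta> lab v {i, j})" using vertex_in_subtree[OF w(1)] eq by simp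
  then have "subtree \<Delta> lab w ({1..n} - {k}) = subtree \<Delta> lab v ({1..n} - {k})"
    if "k \<in> {1..n} - {i, j}" for k
    using that i j by (intro subtree_eq) auto
  then show "c = (\<Prod>k\<in>{1..n} - {i, j}. \<phi> (subtree \<Delta> lab v ({1..n} - {k})))"
    unfolding c I[symmetric] by (intro prod.cong) auto
qed

end

end

theory Submission
  imports Defs
begin

text \<open>Join two bounded geodesics by a walk in the tree and induct on its length. If an end of the
  walk can be shortened, by moving the geodesic there across the adjacent edge while keeping its
  value bounded, then we are done by induction. Otherwise the first and the last edge of the walk
  both point outwards, from the larger to the smaller absolute value. So some interior
  vertex has two edges of the walk pointing away from it, and the geodesic through these two edges
  has value at most \<open>2\<close> in absolute value. It splits the walk into two shorter ones.

  Two bounded geodesics through one vertex, or on the two sides of one edge with the same labels,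
  are linked by a common neighbour: the product of the values of the two candidates is at most
  \<open>K\<^sup>2\<close>, so one of them is bounded by \<open>K\<close>.\<close>

section \<open>Products over complements of pairs, and chains\<close>

text \<open>On both sides \<open>x i\<close>, \<open>x j\<close>, \<open>x k\<close>,
  \<open>x l\<close> occur once and every other factor twice. This trades two disjoint pairs for two
  pairs that each meet both of them.\<close>

lemma prod_Diff_pair_exchange:
  fixes x :: "'a \<Rightarrow> 'b::comm_monoid_mult"
  assumes "finite N" "{i, j, k, l} \<subseteq> N" "distinct [i, j, k, l]"
  shows "prod x (N - {i, j}) * prod x (N - {k, l}) = prod x (N - {i, k}) * prod x (N - {j, l})"
proof -
  have *: "prod x (N - {a, b}) = x c * (x d * prod x (N - {a, b, c, d}))"
    if "c \<in> N" "d \<in> N" "distinct [a, b, c, d]" for a b c d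
  proof -
    have "N - {a, b} = insert c (insert d (N - {a, b, c, d}))" using that by auto
    then have "prod x (N - {a, b}) = prod x (insert c (insert d (N - {a, b, c, d})))"
      by (rule arg_cong)
    also have "\<dots> = x c * (x d * prod x (N - {a, b, c, d}))"
      using that assms(1) by simp
    finally show ?thesis .
  qed
  have sets: "{k, l, i, j} = {i, j, k, l}" "{i, k, j, l} = {i, j, k, l}" "{j, l, i, k} = {i, j, k, l}"
    by auto
  have ne: "j \<noteq> i" "k \<noteq> i" "l \<noteq> i" "k \<noteq> j" "l \<noteq> j" "l \<noteq> k" using assms(3) by auto
  \<comment> \<open>Instantiation follows the order of occurrence \<open>c\<close>,
    \<open>d\<close>, \<open>a\<close>, \<open>b\<close>: the first two arguments are the factors
    split off, the last two the pair removed.\<close>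
  show ?thesis
    using *[of k l i j] *[of i j k l] *[of j l i k] *[of i k j l] assms(2) ne ne[symmetric]
    unfolding sets by (simp add: ac_simps)
qed

lemma min_le_if_mult_le_square:
  fixes a b K :: real
  assumes "a * b \<le> K * K" "0 \<le> K"
  shows "a \<le> K \<or> b \<le> K"
proof (rule ccontr)
  assume "\<not> ?thesis"
  then have "K * K < a * b" using assms(2) by (intro mult_strict_mono') auto
  with assms(1) show False by simp
qed

text \<open>Bridges reflexive transitive closures, convenient for induction, and the explicit lists
  in \<open>edge_connected\<close>.\<close>

lemma rtrancl_imp_chain:
  assumes "(x, y) \<in> R\<^sup>*" "x \<in> P" "R \<subseteq> P \<times> P"
  shows "\<exists>zs. zs \<noteq> [] \<and> set zs \<subseteq> P \<and> hd zs = x \<and> last zs = y \<and>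
    (\<forall>k. Suc k < length zs \<longrightarrow> (zs ! k, zs ! Suc k) \<in> R)"
  using assms(1)
proof (induction rule: rtrancl_induct)
  case base
  show ?case using assms(2) by (intro exI[of _ "[x]"]) simp
next
  case (step y z)
  then obtain zs where zs: "zs \<noteq> []" "set zs \<subseteq> P" "hd zs = x" "last zs = y"
    "\<forall>k. Suc k < length zs \<longrightarrow> (zs ! k, zs ! Suc k) \<in> R" by blast
  have "((zs @ [z]) ! k, (zs @ [z]) ! Suc k) \<in> R" if "Suc k < length (zs @ [z])" for k
  proof (cases "Suc k < length zs")
    case True
    then show ?thesis using zs(5) by (simp add: nth_append)
  next
    case False
    with that have k: "Suc k = length zs" by simp
    then have "zs ! k = y" using zs(1,4) by (metis diff_Suc_1 last_conv_nth)
    then show ?thesis using k step(2) by (simp add: nth_append)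
  qed
  then show ?case using zs step(2) assms(3) by (intro exI[of _ "zs @ [z]"]) auto
qed

section \<open>Edges and neighbours in the labelled tree\<close>

lemma (in labelled_regular_tree) edge_vertices:
  assumes "{v, w} \<in> edges \<Delta>"
  shows "v \<in> vertices \<Delta>" "w \<in> vertices \<Delta>"
  using tree assms by (auto simp: is_tree_def simple_graph_def)

lemma (in labelled_regular_tree) neighbour_in_subtree:
  assumes "{v, w} \<in> edges \<Delta>" "lab {v, w} \<in> I"
  shows "w \<in> vertices (subtree \<Delta> lab v I)"
  using assms edge_vertices[OF assms(1)]
  by (auto simp: subtree_def component_def Let_def adjacency_def)

lemma (in labelled_regular_tree) edge_in_subtree:
  assumes "{v, w} \<in> edges \<Delta>" "lab {v, w} \<in> I"
  shows "{v, w} \<in> edges (subtree \<Delta> lab v I)"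
  using assms neighbour_in_subtree[OF assms] edge_vertices[OF assms(1)]
    vertex_in_subtree[of v I]
  by (auto simp: subtree_def component_def Let_def)

lemma (in labelled_regular_tree) ex_neighbour:
  assumes "v \<in> vertices \<Delta>" "i \<in> {1..n}"
  obtains w where "{v, w} \<in> edges \<Delta>" "lab {v, w} = i"
proof -
  obtain e where e: "e \<in> edges \<Delta>" "v \<in> e" "lab e = i" using ex_edge[OF assms] .
  with tree have "card e = 2" by (auto simp: is_tree_def simple_graph_def)
  then obtain w where "e = {v, w}" using e(2) by (auto simp: card_2_iff)
  with e that show ?thesis by blast
qed

section \<open>Weights and links of geodesics\<close>

locale nondihedral_hurwitz = labelled_regular_tree n \<Delta> lab v0
  for n :: nat and \<Delta> :: "'v ugraph" and lab :: "'v set \<Rightarrow> nat" and v0 :: 'v +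
  fixes \<phi> :: "'v ugraph \<Rightarrow> complex" and K :: real
  assumes hurwitz: "hurwitz_map n \<Delta> lab \<phi>"
    and not_dihedral: "\<not> dihedral n \<Delta> lab \<phi>"
    and K: "K \<ge> 2"
begin

definition val :: "'v \<Rightarrow> nat \<Rightarrow> complex" where
  "val v i = \<phi> (subtree \<Delta> lab v ({1..n} - {i}))"

text \<open>For distinct labels this is the absolute value of the extended Hurwitz map on the
  geodesic through \<open>v\<close>, written locally at \<open>v\<close> to avoid the definite
  description in \<open>geodesic_value\<close>.\<close>

definition weight :: "'v \<Rightarrow> nat \<Rightarrow> nat \<Rightarrow> real" where
  "weight v i j = (\<Prod>k\<in>{1..n} - {i, j}. norm (val v k))"

text \<open>Boundedness of both members is built in, so a chain of links never leaves the bounded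
  geodesics.\<close>

definition link :: "'v ugraph rel" where
  "link = {(\<gamma>, \<delta>). \<gamma> \<in> bounded_geodesics n \<Delta> lab \<phi> K \<and> \<delta> \<in> bounded_geodesics n \<Delta> lab \<phi> K \<and>
     edges \<gamma> \<inter> edges \<delta> \<noteq> {}}"

lemma link_rtrancl_sym: "(\<gamma>, \<delta>) \<in> link\<^sup>* \<Longrightarrow> (\<delta>, \<gamma>) \<in> link\<^sup>*"
  by (rule symD[OF sym_rtrancl]) (auto simp: link_def sym_def)

lemma weight_commute: "weight v i j = weight v j i"
  by (simp add: weight_def insert_commute)

lemma bounded_geodesics_iff:
  assumes "v \<in> vertices \<Delta>" "i \<in> {1..n}" "j \<in> {1..n}" "i \<noteq> j"
  shows "subtree \<Delta> lab v {i, j} \<in> bounded_geodesics n \<Delta> lab \<phi> K \<longleftrightarrow> weight v i j \<le> K"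
proof -
  have "subtree \<Delta> lab v {i, j} \<in> alternating_geodesics n \<Delta> lab"
    using assms unfolding alternating_geodesics_def by blast
  then show ?thesis
    by (simp add: bounded_geodesics_def geodesic_value_eq[OF assms] weight_def val_def prod_norm)
qed

lemma linkI:
  assumes "v \<in> vertices \<Delta>" "i \<in> {1..n}" "j \<in> {1..n}" "k \<in> {1..n}" "i \<noteq> j" "i \<noteq> k"
    "weight v i j \<le> K" "weight v i k \<le> K"
  shows "(subtree \<Delta> lab v {i, j}, subtree \<Delta> lab v {i, k}) \<in> link"
proof -
  obtain w where "{v, w} \<in> edges \<Delta>" "lab {v, w} = i" using ex_neighbour assms by blast
  then have "{v, w} \<in> edges (subtree \<Delta> lab v {i, j}) \<inter> edges (subtree \<Delta> lab v {i, k})"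
    by (simp add: edge_in_subtree)
  then show ?thesis unfolding link_def using assms bounded_geodesics_iff by blast
qed

text \<open>The edge survives the deletion of the edges labelled \<open>j\<close>, so both ends lie
  in the same component.\<close>

lemma val_edge:
  assumes "{v, w} \<in> edges \<Delta>" "j \<in> {1..n}" "j \<noteq> lab {v, w}"
  shows "val w j = val v j"
  unfolding val_def
  by (rule arg_cong[where f = \<phi>], rule subtree_eq[OF neighbour_in_subtree[OF assms(1)] order_refl])
    (use assms labels[OF assms(1)] in auto)

lemma val_relation:
  assumes "{v, w} \<in> edges \<Delta>"
  shows "val v (lab {v, w}) + val w (lab {v, w}) = (\<Prod>j\<in>{1..n} - {lab {v, w}}. val v j)"
  using hurwitz assms unfolding hurwitz_map_def val_def by blast

section \<open>Geodesics through a common vertex\<close>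

text \<open>Pairs with a common label share the edge at \<open>v\<close> carrying it. For disjoint
  pairs, \<open>{i, k}\<close> and \<open>{j, l}\<close> each meet both, and by the exchange
  identity one of them is bounded.\<close>

lemma same_vertex_connected:
  assumes v: "v \<in> vertices \<Delta>" and N: "i \<in> {1..n}" "j \<in> {1..n}" "k \<in> {1..n}" "l \<in> {1..n}"
    and ne: "i \<noteq> j" "k \<noteq> l" and le: "weight v i j \<le> K" "weight v k l \<le> K"
  shows "(subtree \<Delta> lab v {i, j}, subtree \<Delta> lab v {k, l}) \<in> link\<^sup>*"
proof -
  \<comment> \<open>The label \<open>a\<close> is the shared one. Instances below list the labels in
    the order of occurrence \<open>a\<close>, \<open>c\<close>, \<open>d\<close>,
    \<open>b\<close>.\<close>
  have common: "(subtree \<Delta> lab v {a, b}, subtree \<Delta> lab v {c, d}) \<in> link\<^sup>*"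
    if prem: "a \<in> {c, d}" "{a, b, c, d} \<subseteq> {1..n}" "a \<noteq> b" "c \<noteq> d"
      "weight v a b \<le> K" "weight v c d \<le> K" for a b c d
  proof -
    obtain e where e: "{c, d} = {a, e}" "a \<noteq> e" "e \<in> {1..n}"
      using prem(1,2,4) that[of c] that[of d] by (cases "a = c") auto
    have "weight v a e \<le> K" using prem(6) e(1) by (simp add: weight_def)
    then show ?thesis using linkI[OF v, of a b e] prem(2,3,5) e by (simp add: r_into_rtrancl)
  qed
  show ?thesis
  proof (cases "{i, j} \<inter> {k, l} = {}")
    case False
    then consider "i \<in> {k, l}" | "j \<in> {k, l}" by blast
    then show ?thesis
    proof cases
      case 1
      then show ?thesis using common[of i k l j] N ne le by simp
    next
      case 2
      then show ?thesis
        using common[of j k l i] N ne le by (simp add: weight_commute insert_commute)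
    qed
  next
    case True
    have "weight v i j * weight v k l = weight v i k * weight v j l"
      unfolding weight_def by (rule prod_Diff_pair_exchange) (use True N ne in auto)
    moreover have "weight v i j * weight v k l \<le> K * K"
      using le K by (intro mult_mono) (auto simp: weight_def intro: prod_nonneg)
    ultimately have "weight v i k \<le> K \<or> weight v j l \<le> K"
      using K by (intro min_le_if_mult_le_square) auto
    then show ?thesis
    proof
      assume h: "weight v i k \<le> K"
      have "(subtree \<Delta> lab v {i, j}, subtree \<Delta> lab v {i, k}) \<in> link\<^sup>*"
        using common[of i i k j] True N ne le h by auto
      moreover have "(subtree \<Delta> lab v {k, i}, subtree \<Delta> lab v {k, l}) \<in> link\<^sup>*"
        using common[of k k l i] True N ne le h by (auto simp: weight_commute)
      ultimately show ?thesis by (simp add: insert_commute)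
    next
      assume h: "weight v j l \<le> K"
      have "(subtree \<Delta> lab v {j, i}, subtree \<Delta> lab v {j, l}) \<in> link\<^sup>*"
        using common[of j j l i] True N ne le h by (auto simp: weight_commute)
      moreover have "(subtree \<Delta> lab v {l, j}, subtree \<Delta> lab v {k, l}) \<in> link\<^sup>*"
        using common[of l k l j] True N ne le h by (auto simp: weight_commute)
      ultimately show ?thesis by (simp add: insert_commute)
    qed
  qed
qed

section \<open>Crossing an edge\<close>

text \<open>Isolates the only factor that can change across an edge labelled
  \<open>k\<close>.\<close>

lemma weight_eq_mult:
  assumes "k \<in> {1..n}" "k \<noteq> i" "k \<noteq> j"
  shows "weight v i j = norm (val v k) * (\<Prod>m\<in>{1..n} - {i, j, k}. norm (val v m))"
proof -
  have "{1..n} - {i, j} = insert k ({1..n} - {i, j, k})" using assms by auto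
  then show ?thesis by (simp add: weight_def)
qed

lemma prod_rest_edge:
  assumes "{v, w} \<in> edges \<Delta>"
  shows "(\<Prod>m\<in>{1..n} - {i, j, lab {v, w}}. norm (val w m)) =
    (\<Prod>m\<in>{1..n} - {i, j, lab {v, w}}. norm (val v m))"
  using val_edge[OF assms] by (intro prod.cong) auto

lemma subtree_edge_eq:
  assumes "{v, w} \<in> edges \<Delta>" "lab {v, w} \<in> I"
  shows "subtree \<Delta> lab w I = subtree \<Delta> lab v I"
  by (rule subtree_eq[OF neighbour_in_subtree[OF assms] order_refl])

text \<open>If the edge is labelled \<open>i\<close> or \<open>j\<close>, both geodesics coincide.
  Otherwise, with \<open>k\<close> its label, the candidates for a common neighbour are
  \<open>{k, i}\<close> and \<open>{k, j}\<close>: each contains the edge, hence is the same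
  geodesic seen from either end.\<close>

lemma edge_connected_across:
  assumes e: "{v, w} \<in> edges \<Delta>" and N: "i \<in> {1..n}" "j \<in> {1..n}" and ne: "i \<noteq> j"
    and le: "weight v i j \<le> K" "weight w i j \<le> K"
  shows "(subtree \<Delta> lab v {i, j}, subtree \<Delta> lab w {i, j}) \<in> link\<^sup>*"
proof (cases "lab {v, w} \<in> {i, j}")
  case True
  then show ?thesis using subtree_edge_eq[OF e] by simp
next
  case False
  define k where "k = lab {v, w}"
  define Q where "Q = (\<Prod>m\<in>{1..n} - {i, j, k}. norm (val v m))"
  have k: "k \<in> {1..n}" "k \<noteq> i" "k \<noteq> j" using labels[OF e] False by (auto simp: k_def)
  have Q: "Q \<ge> 0" by (simp add: Q_def prod_nonneg)
  have vk: "norm (val v k) * Q \<le> K"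
    using le(1) weight_eq_mult[OF k] by (simp add: Q_def)
  have wk: "norm (val w k) * Q \<le> K"
    using le(2) weight_eq_mult[OF k] prod_rest_edge[OF e, of i j] by (simp add: Q_def k_def)
  have "{1..n} - {k} = insert i (insert j ({1..n} - {i, j, k}))" using N k by auto
  then have "(\<Prod>m\<in>{1..n} - {k}. val v m) = (\<Prod>m\<in>insert i (insert j ({1..n} - {i, j, k})). val v m)"
    by (rule arg_cong)
  also have "\<dots> = val v i * (val v j * (\<Prod>m\<in>{1..n} - {i, j, k}. val v m))"
    using ne by simp
  finally have "norm (val v k + val w k) = norm (val v i) * norm (val v j) * Q"
    using val_relation[OF e] by (simp only: k_def[symmetric] Q_def norm_mult prod_norm mult.assoc)
  then have "norm (val v i) * norm (val v j) * Q \<le> norm (val v k) + norm (val w k)"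
    using norm_triangle_ineq[of "val v k" "val w k"] by simp
  \<comment> \<open>The second factor \<open>Q\<close> turns the left side into the product of the
    two candidate weights, and the right side into the sum of the two given weights.\<close>
  then have "norm (val v i) * norm (val v j) * Q * Q \<le> (norm (val v k) + norm (val w k)) * Q"
    using Q by (intro mult_right_mono)
  also have "\<dots> \<le> 2 * K" using vk wk by (simp add: distrib_right)
  \<comment> \<open>Here \<open>K\<close> being at least 2 enters.\<close>
  also have "\<dots> \<le> K * K" using K by simp
  also have "norm (val v i) * norm (val v j) * Q * Q = weight v k j * weight v k i"
    using weight_eq_mult[of i k j v] weight_eq_mult[of j k i v] N k ne
    by (simp add: Q_def insert_commute)
  finally have "weight v k j \<le> K \<or> weight v k i \<le> K"
    using K by (intro min_le_if_mult_le_square) auto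
  then obtain m where m: "m \<in> {1..n}" "k \<noteq> m" "weight v k m \<le> K" using N k by blast
  \<comment> \<open>The weight omits the factor at \<open>k\<close>, the only one that changes
    across the edge.\<close>
  have "weight w k m = weight v k m"
    unfolding weight_def using val_edge[OF e] by (intro prod.cong) (auto simp: k_def)
  then have "(subtree \<Delta> lab w {k, m}, subtree \<Delta> lab w {i, j}) \<in> link\<^sup>*"
    using same_vertex_connected[of w k m i j] edge_vertices[OF e] m k N ne le by simp
  moreover have "subtree \<Delta> lab w {k, m} = subtree \<Delta> lab v {k, m}"
    by (rule subtree_edge_eq[OF e]) (simp add: k_def)
  moreover have "(subtree \<Delta> lab v {i, j}, subtree \<Delta> lab v {k, m}) \<in> link\<^sup>*"
    using same_vertex_connected[of v i j k m] edge_vertices[OF e] m k N ne le by simp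
  ultimately show ?thesis by simp
qed

section \<open>Orientation of edges and forks\<close>

text \<open>Only the factor at the label of the edge changes, and the remaining factors have a
  common nonnegative product; so a growing weight forces this factor to grow.\<close>

lemma norm_val_less_if_weight_gt:
  assumes e: "{v, w} \<in> edges \<Delta>" and le: "weight v i j \<le> K" and gt: "weight w i j > K"
  shows "norm (val v (lab {v, w})) < norm (val w (lab {v, w}))"
proof -
  define k where "k = lab {v, w}"
  define Q where "Q = (\<Prod>m\<in>{1..n} - {i, j, k}. norm (val v m))"
  have "k \<in> {1..n}" using labels[OF e] by (simp add: k_def)
  moreover have "k \<notin> {i, j}"
  proof
    assume "k \<in> {i, j}"
    then have "weight w i j = weight v i j"
      unfolding weight_def using val_edge[OF e] by (intro prod.cong) (auto simp: k_def)
    with le gt show False by simp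
  qed
  ultimately have k: "k \<in> {1..n}" "k \<noteq> i" "k \<noteq> j" by auto
  have "norm (val v k) * Q < norm (val w k) * Q"
    using le gt weight_eq_mult[OF k] prod_rest_edge[OF e, of i j] by (simp add: Q_def k_def)
  moreover have "Q \<ge> 0" by (simp add: Q_def prod_nonneg)
  ultimately show ?thesis unfolding k_def[symmetric] by (meson mult_right_mono not_less)
qed

text \<open>The left side is the norm of the product in the Hurwitz relation, hence of the sum of
  the two values across the edge, of which the one at \<open>v\<close> dominates.\<close>

lemma norm_prod_le_if_descends:
  assumes e: "{v, w} \<in> edges \<Delta>"
    and le: "norm (val w (lab {v, w})) \<le> norm (val v (lab {v, w}))"
    and q: "q \<in> {1..n}" "q \<noteq> lab {v, w}"
  shows "norm (val v q) * weight v (lab {v, w}) q \<le> 2 * norm (val v (lab {v, w}))"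
proof -
  have "{1..n} - {lab {v, w}} = insert q ({1..n} - {lab {v, w}, q})" using q by auto
  then have "norm (val v q) * weight v (lab {v, w}) q = norm (val v (lab {v, w}) + val w (lab {v, w}))"
    by (simp add: val_relation[OF e] weight_def norm_mult prod_norm)
  also have "\<dots> \<le> 2 * norm (val v (lab {v, w}))"
    using norm_triangle_ineq[of "val v (lab {v, w})" "val w (lab {v, w})"] le by linarith
  finally show ?thesis .
qed

text \<open>Writing \<open>x\<close>, \<open>y\<close> for the norms at \<open>v\<close> and
  \<open>P\<close> for the weight, the two edges give \<open>y * P <= 2 * x\<close> and
  \<open>x * P <= 2 * y\<close>. Add these and cancel \<open>x + y\<close>, which is positive
  because the map is not dihedral.\<close>

lemma fork_weight_le_2:
  assumes e: "{v, u} \<in> edges \<Delta>" "{v, w} \<in> edges \<Delta>" and ne: "lab {v, u} \<noteq> lab {v, w}"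
    and le: "norm (val u (lab {v, u})) \<le> norm (val v (lab {v, u}))"
      "norm (val w (lab {v, w})) \<le> norm (val v (lab {v, w}))"
  shows "weight v (lab {v, u}) (lab {v, w}) \<le> 2"
proof -
  define p q where "p = lab {v, u}" and "q = lab {v, w}"
  define x y P where "x = norm (val v p)" and "y = norm (val v q)" and "P = weight v p q"
  have pq: "p \<in> {1..n}" "q \<in> {1..n}" using labels e by (auto simp: p_def q_def)
  have 1: "y * P \<le> 2 * x"
    using norm_prod_le_if_descends[OF e(1) le(1), of q] pq ne
    by (simp add: p_def q_def x_def y_def P_def)
  have 2: "x * P \<le> 2 * y"
    using norm_prod_le_if_descends[OF e(2) le(2), of p] pq ne
    by (simp add: p_def q_def x_def y_def P_def weight_commute)
  have "x \<noteq> 0 \<or> y \<noteq> 0"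
    using not_dihedral edge_vertices(1)[OF e(1)] pq ne
    unfolding dihedral_def x_def y_def val_def p_def q_def norm_eq_zero by blast
  moreover have "x \<ge> 0" "y \<ge> 0" by (auto simp: x_def y_def)
  ultimately have "x + y > 0" by linarith
  moreover have "(x + y) * P \<le> (x + y) * 2" using 1 2 by (simp add: algebra_simps)
  ultimately have "P \<le> 2" by (meson mult_le_cancel_left_pos)
  then show ?thesis by (simp add: P_def p_def q_def)
qed

section \<open>Induction on the length of a walk\<close>

text \<open>Walks may repeat vertices, so subwalks and spliced walks fall under the induction
  hypothesis without further conditions.\<close>

lemma walk_connected:
  assumes "(v, w) \<in> adjacency \<Delta> ^^ d" "v \<in> vertices \<Delta>" "w \<in> vertices \<Delta>"
    and "i \<in> {1..n}" "j \<in> {1..n}" "k \<in> {1..n}" "l \<in> {1..n}" "i \<noteq> j" "k \<noteq> l"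
    and "weight v i j \<le> K" "weight w k l \<le> K"
  shows "(subtree \<Delta> lab v {i, j}, subtree \<Delta> lab w {k, l}) \<in> link\<^sup>*"
  using assms
proof (induction d arbitrary: v w i j k l rule: less_induct)
  case (less d)
  note N = less.prems(4-9) and le = less.prems(10,11)
  obtain f where f: "f 0 = v" "f d = w" and step: "\<And>t. t < d \<Longrightarrow> {f t, f (Suc t)} \<in> edges \<Delta>"
    using less.prems(1) by (auto simp: relpow_fun_conv adjacency_def)
  have walk: "(f a, f b) \<in> adjacency \<Delta> ^^ (b - a)" if "a \<le> b" "b \<le> d" for a b
    unfolding relpow_fun_conv using that step
    by (intro exI[of _ "\<lambda>t. f (a + t)"]) (auto simp: adjacency_def)
  have fV: "f t \<in> vertices \<Delta>" if "t \<le> d" for t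
    using that step[of t] edge_vertices f less.prems by (cases "t = d") auto
  show ?case
  proof (cases "d = 0")
    case True
    then show ?thesis using same_vertex_connected less.prems by simp
  next
    case False
    then have d: "0 < d" "d - 1 < d" "Suc (d - 1) = d" by auto
    have first: "{v, f 1} \<in> edges \<Delta>" using step[of 0] f d by simp
    have last: "{w, f (d - 1)} \<in> edges \<Delta>"
      using step[of "d - 1"] f d by (simp add: insert_commute)
    consider "weight (f 1) i j \<le> K" | "weight (f (d - 1)) k l \<le> K"
      | "weight (f 1) i j > K" "weight (f (d - 1)) k l > K" by linarith
    then show ?thesis
    proof cases
      case 1
      have "(f 1, w) \<in> adjacency \<Delta> ^^ (d - 1)" using walk[of 1 d] f d by simp
      from less.IH[OF d(2) this _ _ N 1 le(2)] edge_connected_across[OF first N(1,2,5) le(1) 1]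
      show ?thesis using fV[of 1] d less.prems by simp
    next
      case 2
      have "(v, f (d - 1)) \<in> adjacency \<Delta> ^^ (d - 1)" using walk[of 0 "d - 1"] f d by simp
      from less.IH[OF d(2) this _ _ N le(1) 2]
        link_rtrancl_sym[OF edge_connected_across[OF last N(3,4,6) le(2) 2]]
      show ?thesis using fV[of "d - 1"] d less.prems by simp
    next
      case 3
      \<comment> \<open>\<open>D t\<close> says that step \<open>t\<close> does not decrease the
        absolute value. It holds at the first step and fails at the last.\<close>
      define D where "D t \<longleftrightarrow>
        norm (val (f t) (lab {f t, f (Suc t)})) \<le> norm (val (f (Suc t)) (lab {f t, f (Suc t)}))" for t
      have D0: "D 0"
        using norm_val_less_if_weight_gt[OF first le(1) 3(1)] f by (simp add: D_def)
      have Dd: "\<not> D (d - 1)"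
        using norm_val_less_if_weight_gt[OF last le(2) 3(2)] f d by (simp add: D_def insert_commute)
      \<comment> \<open>The first failure is not at 0, so the step before it does not decrease and
        step \<open>t\<close> strictly decreases: both edges of the walk at \<open>f t\<close>
        descend away from \<open>f t\<close>.\<close>
      define t where "t = (LEAST t. \<not> D t)"
      have t: "\<not> D t" unfolding t_def using Dd by (rule LeastI)
      have td: "t \<le> d - 1" unfolding t_def using Dd by (rule Least_le)
      from t D0 obtain s where s: "t = Suc s" by (cases t) auto
      have Ds: "D s" using not_less_Least[of s "\<lambda>t. \<not> D t"] s t_def by auto
      have sd: "Suc (Suc s) \<le> d" using td s d by linarith
      let ?u = "f (Suc s)"
      have e: "{?u, f s} \<in> edges \<Delta>" "{?u, f (Suc (Suc s))} \<in> edges \<Delta>"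
        using step[of s] step[of "Suc s"] sd by (auto simp: insert_commute)
      show ?thesis
      proof (cases "lab {?u, f s} = lab {?u, f (Suc (Suc s))}")
        case True
        \<comment> \<open>Labels at a vertex are distinct, so the walk backtracks at
          \<open>?u\<close>; removing the two steps gives a walk of length
          \<open>d - 2\<close>.\<close>
        have "{?u, f s} = {?u, f (Suc (Suc s))}"
          using distinct_labels[OF edge_vertices(1)[OF e(1)]] True e by (auto dest!: inj_onD)
        then have eq: "f s = f (Suc (Suc s))" by (auto simp: doubleton_eq_iff)
        have "(v, f s) \<in> adjacency \<Delta> ^^ s" "(f s, w) \<in> adjacency \<Delta> ^^ (d - Suc (Suc s))"
          using walk[of 0 s] walk[of "Suc (Suc s)" d] eq f sd by auto
        then have "(v, w) \<in> adjacency \<Delta> ^^ (s + (d - Suc (Suc s)))"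
          unfolding relpow_add by blast
        from less.IH[OF _ this less.prems(2,3) N le] show ?thesis using sd by simp
      next
        case False
        let ?p = "lab {?u, f s}" and ?q = "lab {?u, f (Suc (Suc s))}"
        have "weight ?u ?p ?q \<le> 2"
          using fork_weight_le_2[OF e False] Ds t s by (simp add: D_def insert_commute)
        then have W: "weight ?u ?p ?q \<le> K" using K by simp
        have pq: "?p \<in> {1..n}" "?q \<in> {1..n}" using labels e by auto
        \<comment> \<open>Both pieces are shorter than \<open>d\<close>, since \<open>?u\<close> is
          neither the first nor the last position of the walk.\<close>
        have walks: "(v, ?u) \<in> adjacency \<Delta> ^^ Suc s" "(?u, w) \<in> adjacency \<Delta> ^^ (d - Suc s)"
          using walk[of 0 "Suc s"] walk[of "Suc s" d] f sd by auto
        have uV: "?u \<in> vertices \<Delta>" using edge_vertices(1)[OF e(1)] .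
        have "(subtree \<Delta> lab v {i, j}, subtree \<Delta> lab ?u {?p, ?q}) \<in> link\<^sup>*"
          using less.IH[OF _ walks(1) less.prems(2) uV N(1,2) pq N(5) False le(1) W] sd by simp
        moreover have "(subtree \<Delta> lab ?u {?p, ?q}, subtree \<Delta> lab w {k, l}) \<in> link\<^sup>*"
          using less.IH[OF _ walks(2) uV less.prems(3) pq N(3,4) False N(6) W le(2)] sd by simp
        ultimately show ?thesis by (rule rtrancl_trans)
      qed
    qed
  qed
qed

section \<open>From walks to edge-connectedness\<close>

lemma bounded_geodesics_connected:
  assumes "\<alpha> \<in> bounded_geodesics n \<Delta> lab \<phi> K" "\<beta> \<in> bounded_geodesics n \<Delta> lab \<phi> K"
  shows "(\<alpha>, \<beta>) \<in> link\<^sup>*"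
proof -
  have rep: "\<exists>v i j. \<gamma> = subtree \<Delta> lab v {i, j} \<and> v \<in> vertices \<Delta> \<and> i \<in> {1..n} \<and> j \<in> {1..n} \<and>
      i \<noteq> j \<and> weight v i j \<le> K" if "\<gamma> \<in> bounded_geodesics n \<Delta> lab \<phi> K" for \<gamma>
  proof -
    have "\<gamma> \<in> alternating_geodesics n \<Delta> lab" using that by (simp add: bounded_geodesics_def)
    then show ?thesis
      unfolding alternating_geodesics_def using that bounded_geodesics_iff by blast
  qed
  obtain v i j where \<alpha>: "\<alpha> = subtree \<Delta> lab v {i, j}" "v \<in> vertices \<Delta>" "i \<in> {1..n}" "j \<in> {1..n}"
    "i \<noteq> j" "weight v i j \<le> K" using rep[OF assms(1)] by blast
  obtain w k l where \<beta>: "\<beta> = subtree \<Delta> lab w {k, l}" "w \<in> vertices \<Delta>" "k \<in> {1..n}" "l \<in> {1..n}"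
    "k \<noteq> l" "weight w k l \<le> K" using rep[OF assms(2)] by blast
  have "(v, w) \<in> (adjacency \<Delta>)\<^sup>*"
    using tree \<alpha>(2) \<beta>(2) by (auto simp: is_tree_def connected_graph_def)
  then obtain d where "(v, w) \<in> adjacency \<Delta> ^^ d" by (auto simp: rtrancl_power)
  then show ?thesis unfolding \<alpha>(1) \<beta>(1) by (rule walk_connected) (use \<alpha> \<beta> in auto)
qed

lemma edge_connected_bounded_geodesics: "edge_connected (bounded_geodesics n \<Delta> lab \<phi> K)"
  unfolding edge_connected_def
proof (intro ballI)
  fix \<alpha> \<beta>
  assume *: "\<alpha> \<in> bounded_geodesics n \<Delta> lab \<phi> K" "\<beta> \<in> bounded_geodesics n \<Delta> lab \<phi> K"
  have "link \<subseteq> bounded_geodesics n \<Delta> lab \<phi> K \<times> bounded_geodesics n \<Delta> lab \<phi> K"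
    by (auto simp: link_def)
  from rtrancl_imp_chain[OF bounded_geodesics_connected[OF *] *(1) this]
  show "\<exists>\<gamma>s. \<gamma>s \<noteq> [] \<and> set \<gamma>s \<subseteq> bounded_geodesics n \<Delta> lab \<phi> K \<and> hd \<gamma>s = \<alpha> \<and> last \<gamma>s = \<beta> \<and>
      (\<forall>k. Suc k < length \<gamma>s \<longrightarrow> edges (\<gamma>s ! k) \<inter> edges (\<gamma>s ! Suc k) \<noteq> {})"
    unfolding link_def by blast
qed

end

theorem proposition2p3:
  fixes n :: nat and \<Delta> :: "'v ugraph" and lab :: "'v set \<Rightarrow> nat" and v0 :: 'v
    and \<phi> :: "'v ugraph \<Rightarrow> complex" and K :: real
  assumes "n \<ge> 3"
    and "labelled_regular_tree n \<Delta> lab v0"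
    and "hurwitz_map n \<Delta> lab \<phi>"
    and "\<not> dihedral n \<Delta> lab \<phi>"
    and "K \<ge> 2"
  shows "edge_connected (bounded_geodesics n \<Delta> lab \<phi> K)"
proof -
  interpret labelled_regular_tree n \<Delta> lab v0 by (rule assms(2))
  interpret nondihedral_hurwitz n \<Delta> lab v0 \<phi> K by unfold_locales (use assms in auto)
  show ?thesis by (rule edge_connected_bounded_geodesics)
qed

end
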